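(* Let $\mathbf{A}\in\mathbb{R}^{N\times N}$ be the coefficient matrix of the linear ODE system $\frac{d\mathbf{u}}{dt}=\mathbf{A}\mathbf{u}+\mathbf{b}$ obtained by the finite volume spatial discretisation, described in the context, of the $m$-layer diffusion problem with Type GI or Type GII conditions at each interface. Suppose the time step $\tau>0$ satisfies all of the following conditions: 1. (interior) $\tau\le\dfrac{h_i^2}{2D_i}$ for all $i=1,\dots,m$; 2. (left Robin condition) if $a_L\neq 0$ and $b_L\ne0$, then $\tau\le\left[\dfrac{2b_L}{2b_L+a_Lh_1}\right]\dfrac{h_1^2}{2D_1}$; 3. (right Robin condition) if $a_R\neq 0$ and $b_R\ne0$, then $\tau\le\left[\dfrac{2b_R}{2b_R+a_Rh_m}\right]\dfrac{h_m^2}{2D_m}$; 4. for every $i\in\{1,\dots,m-1\}$ such that Type GI conditions with $\theta_i>1$ are imposed at $x=l_i$, $$\tau\le\frac{(\gamma_ih_i\theta_iD_{i+1}+\gamma_{i+1}h_{i+1}D_i)h_ih_{i+1}}{\left(2\theta_i\gamma_ih_{i+1}+(1+\theta_i)\gamma_{i+1}h_i\right)D_iD_{i+1}};$$ 5. for every $i\in\{1,\dots,m-1\}$ such that Type GI conditions with $\theta_i<1$ are imposed at $x=l_i$, $$\tau\le\frac{(\gamma_ih_i\theta_iD_{i+1}+\gamma_{i+1}h_{i+1}D_i)h_ih_{i+1}}{\left((1+\theta_i)\gamma_ih_{i+1}+2\gamma_{i+1}h_i\right)D_iD_{i+1}};$$ 6. for every $i\in\{1,\dots,m-1\}$ such that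 Type GII conditions are imposed at $x=l_i$, $$\tau\le\min\left\{\left[\frac{2\gamma_i}{(1+\theta_i)H_ih_i+2\gamma_i}\right]\frac{h_i^2}{2D_i},\ \left[\frac{2\gamma_{i+1}}{(1+\theta_i)H_ih_{i+1}+2\gamma_{i+1}}\right]\frac{h_{i+1}^2}{2D_{i+1}}\right\}.$$ (No additional restriction is imposed for Dirichlet or Neumann external boundary conditions, nor at Type GI interfaces with $\theta_i=1$.) Then the forward Euler scheme is stable, i.e. its iteration matrix $\mathbf{A}_F=\mathbf{I}+\tau\mathbf{A}$ has spectral radius $\rho(\mathbf{A}_F)\le1$.
   Context: **Multilayer diffusion problem.** Let $m$ be a positive integer and $l_0<l_1<\dots<l_m$ real numbers. For $i=1,\dots,m$ let $D_i>0$ (diffusivity) and $\gamma_i>0$ (conductivity) be constants. The problem is $$\frac{\partial u_i}{\partial t}=D_i\frac{\partial^2u_i}{\partial x^2},\quad l_{i-1}<x<l_i,\ t>0,\qquad u_i(x,0)=f_i(x),\qquad i=1,\dots,m,$$ $$a_Lu_1(l_0,t)-b_L\frac{\partial u_1}{\partial x}(l_0,t)=c_L,\qquad a_Ru_m(l_m,t)+b_R\frac{\partial u_m}{\partial x}(l_m,t)=c_R,$$ where $a_L,b_L,c_L,a_R,b_R,c_R\ge 0$ are constants with $a_L+b_L>0$, $a_R+b_R>0$, and the case $a_L=a_R=0$ (Neumann conditions on both boundaries) is excluded. The left (right) boundary condition is Dirichlet if $b_L=0$ ($b_R=0$), Neumann if $a_L=0$ ($a_R=0$), and Robin otherwise.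 At each interface $x=l_i$ ($i=1,\dots,m-1$) one of the following pairs of conditions is imposed (the type may differ from interface to interface), with constants $\theta_i>0$, $H_i>0$: - Type GI: $u_i(l_i,t)=\theta_iu_{i+1}(l_i,t)$ and $\gamma_i\frac{\partial u_i}{\partial x}(l_i,t)=\gamma_{i+1}\frac{\partial u_{i+1}}{\partial x}(l_i,t)$. - Type GII: $\gamma_i\frac{\partial u_i}{\partial x}(l_i,t)=H_i(\theta_iu_{i+1}(l_i,t)-u_i(l_i,t))$ and $\gamma_i\frac{\partial u_i}{\partial x}(l_i,t)=\gamma_{i+1}\frac{\partial u_{i+1}}{\partial x}(l_i,t)$. **Mesh.** Let $n\ge 2$ be an integer, $h_i=(l_i-l_{i-1})/n$, and $x_{i,j}=l_{i-1}+jh_i$ for $i=1,\dots,m$, $j=0,\dots,n$. The discrete unknown $u_{i,j}(t)$ approximates $u_i(x_{i,j},t)$. **Unknowns.** The vector $\mathbf{u}$ lists $u_{1,0},u_{1,1},\dots,u_{1,n},u_{2,0},\dots,u_{m,n}$ in this order, but with the following entries removed and, wherever they occur in the equations below, replaced as indicated: - if $b_L=0$, $u_{1,0}$ is removed and replaced by $c_L/a_L$; - if $b_R=0$, $u_{m,n}$ is removed and replaced by $c_R/a_R$; - at each Type GI interface $x=l_i$ with $\theta_i\ge1$, $u_{i+1,0}$ is removed and replaced by $u_{i,n}/\theta_i$; - at each Type GI interface $x=l_i$ with $\theta_i<1$, $u_{i,n}$ is removed and replaced by $\theta_iu_{i+1,0}$. $N$ is the number of remaining unknowns. **Finite volume equations**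 (one for each remaining unknown). - Interior nodes, $1\le i\le m$, $1\le j\le n-1$: $\frac{du_{i,j}}{dt}=\frac{D_i}{h_i^2}(u_{i,j+1}-2u_{i,j}+u_{i,j-1})$. - Left boundary, if $b_L\ne0$: $\frac{du_{1,0}}{dt}=-\frac{2D_1}{h_1}\left[\frac1{h_1}+\frac{a_L}{b_L}\right]u_{1,0}+\frac{2D_1}{h_1^2}u_{1,1}+\frac{2D_1c_L}{h_1b_L}$. - Right boundary, if $b_R\ne0$: $\frac{du_{m,n}}{dt}=\frac{2D_m}{h_m^2}u_{m,n-1}-\frac{2D_m}{h_m}\left[\frac1{h_m}+\frac{a_R}{b_R}\right]u_{m,n}+\frac{2D_mc_R}{h_mb_R}$. - Type GI interface with $\theta_i\ge1$: $\frac{du_{i,n}}{dt}=\frac{2D_iD_{i+1}\theta_i}{\gamma_ih_i\theta_iD_{i+1}+\gamma_{i+1}h_{i+1}D_i}\left[\frac{\gamma_i}{h_i}u_{i,n-1}-\left(\frac{\gamma_i}{h_i}+\frac{\gamma_{i+1}}{\theta_ih_{i+1}}\right)u_{i,n}+\frac{\gamma_{i+1}}{h_{i+1}}u_{i+1,1}\right]$. - Type GI interface with $\theta_i<1$: $\frac{du_{i+1,0}}{dt}=\frac{2D_iD_{i+1}}{\gamma_ih_i\theta_iD_{i+1}+\gamma_{i+1}h_{i+1}D_i}\left[\frac{\gamma_i}{h_i}u_{i,n-1}-\left(\frac{\theta_i\gamma_i}{h_i}+\frac{\gamma_{i+1}}{h_{i+1}}\right)u_{i+1,0}+\frac{\gamma_{i+1}}{h_{i+1}}u_{i+1,1}\right]$.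 - Type GII interface: $\frac{du_{i,n}}{dt}=\frac{2D_i}{\gamma_ih_i}\left[\frac{\gamma_i}{h_i}u_{i,n-1}-\left(H_i+\frac{\gamma_i}{h_i}\right)u_{i,n}+\theta_iH_iu_{i+1,0}\right]$ and $\frac{du_{i+1,0}}{dt}=\frac{2D_{i+1}}{\gamma_{i+1}h_{i+1}}\left[H_iu_{i,n}-\left(\theta_iH_i+\frac{\gamma_{i+1}}{h_{i+1}}\right)u_{i+1,0}+\frac{\gamma_{i+1}}{h_{i+1}}u_{i+1,1}\right]$. Collecting these equations gives $\frac{d\mathbf{u}}{dt}=\mathbf{A}\mathbf{u}+\mathbf{b}$, with $\mathbf{A}\in\mathbb{R}^{N\times N}$ the (tridiagonal) matrix of coefficients of the unknowns and $\mathbf{b}\in\mathbb{R}^N$ the vector of constant terms. **Time stepping and stability.** With $\mathbf{I}$ the $N\times N$ identity matrix and time step $\tau>0$, the forward Euler scheme is $\mathbf{u}^{(k+1)}=\mathbf{A}_F\mathbf{u}^{(k)}+\tau\mathbf{b}$ with $\mathbf{A}_F=\mathbf{I}+\tau\mathbf{A}$. A scheme is called stable (for a given $\tau$) if the spectral radius of its iteration matrix is at most $1$. *)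

theory Defs
  imports "Jordan_Normal_Form.Spectral_Radius"
begin

text \<open>Layers are numbered \<open>1, \<dots>, layers\<close>; layer \<open>i\<close> is the interval from \<open>endpoint (i - 1)\<close> to
  \<open>endpoint i\<close>, and interface \<open>i\<close> (for \<open>1 \<le> i < layers\<close>) separates layers \<open>i\<close> and \<open>i + 1\<close>.
  \<open>GI \<theta>\<close> stands for \<open>u\<^sub>i = \<theta> u\<^sub>i\<^sub>+\<^sub>1\<close> with continuous flux, and \<open>GII \<theta> H\<close> for flux
  \<open>H (\<theta> u\<^sub>i\<^sub>+\<^sub>1 - u\<^sub>i)\<close>, also continuous. The initial data do not occur in the semi-discrete
  equations and are therefore not part of the record.\<close>

datatype interface = GI real | GII real real

record multilayer =
  layers :: nat
  endpoint :: "nat \<Rightarrow> real"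
  diffusivity :: "nat \<Rightarrow> real"
  conductivity :: "nat \<Rightarrow> real"
  aL :: real
  bL :: real
  cL :: real
  aR :: real
  bR :: real
  cR :: real
  iface :: "nat \<Rightarrow> interface"

fun interface_ok :: "interface \<Rightarrow> bool" where
  "interface_ok (GI \<theta>) \<longleftrightarrow> \<theta> > 0"
| "interface_ok (GII \<theta> H) \<longleftrightarrow> \<theta> > 0 \<and> H > 0"

definition multilayer_problem :: "multilayer \<Rightarrow> bool" where
  "multilayer_problem P \<longleftrightarrow>
     layers P \<ge> 1 \<and>
     (\<forall>i<layers P. endpoint P i < endpoint P (i + 1)) \<and>
     (\<forall>i\<in>{1..layers P}. diffusivity P i > 0 \<and> conductivity P i > 0) \<and>
     aL P \<ge> 0 \<and> bL P \<ge> 0 \<and> cL P \<ge> 0 \<and> aR P \<ge> 0 \<and> bR P \<ge> 0 \<and> cR P \<ge> 0 \<and>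
     aL P + bL P > 0 \<and> aR P + bR P > 0 \<and>
     \<not> (aL P = 0 \<and> aR P = 0) \<and>
     (\<forall>i\<in>{1..<layers P}. interface_ok (iface P i))"

definition mesh_width :: "multilayer \<Rightarrow> nat \<Rightarrow> nat \<Rightarrow> real" where
  "mesh_width P n i = (endpoint P i - endpoint P (i - 1)) / real n"

text \<open>The pair \<open>(i, j)\<close> denotes the node \<open>x\<^sub>i\<^sub>,\<^sub>j\<close>, where \<open>1 \<le> i \<le> layers\<close> and \<open>0 \<le> j \<le> n\<close>.\<close>

definition removed_left :: "multilayer \<Rightarrow> nat \<times> nat \<Rightarrow> bool" where
  "removed_left P p \<longleftrightarrow> p = (1, 0) \<and> bL P = 0"

definition removed_right :: "multilayer \<Rightarrow> nat \<Rightarrow> nat \<times> nat \<Rightarrow> bool" where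
  "removed_right P n p \<longleftrightarrow> p = (layers P, n) \<and> bR P = 0"

definition removed_above :: "multilayer \<Rightarrow> nat \<times> nat \<Rightarrow> bool" where
  "removed_above P p \<longleftrightarrow>
     (\<exists>i\<in>{1..<layers P}. \<exists>\<theta>. p = (i + 1, 0) \<and> iface P i = GI \<theta> \<and> \<theta> \<ge> 1)"

definition removed_below :: "multilayer \<Rightarrow> nat \<Rightarrow> nat \<times> nat \<Rightarrow> bool" where
  "removed_below P n p \<longleftrightarrow>
     (\<exists>i\<in>{1..<layers P}. \<exists>\<theta>. p = (i, n) \<and> iface P i = GI \<theta> \<and> \<theta> < 1)"

definition removed :: "multilayer \<Rightarrow> nat \<Rightarrow> nat \<times> nat \<Rightarrow> bool" where
  "removed P n p \<longleftrightarrow>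
     removed_left P p \<or> removed_right P n p \<or> removed_above P p \<or> removed_below P n p"

text \<open>\<open>List.product\<close> enumerates the nodes lexicographically: layer by layer, left to right.\<close>

definition unknowns :: "multilayer \<Rightarrow> nat \<Rightarrow> (nat \<times> nat) list" where
  "unknowns P n = filter (\<lambda>p. \<not> removed P n p) (List.product [1..<layers P + 1] [0..<n + 1])"

definition num_unknowns :: "multilayer \<Rightarrow> nat \<Rightarrow> nat" where
  "num_unknowns P n = length (unknowns P n)"

definition node_index :: "multilayer \<Rightarrow> nat \<Rightarrow> nat \<times> nat \<Rightarrow> nat" where
  "node_index P n p = length (takeWhile (\<lambda>q. q \<noteq> p) (unknowns P n))"

fun interface_ratio :: "interface \<Rightarrow> real" where
  "interface_ratio (GI \<theta>) = \<theta>"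
| "interface_ratio (GII \<theta> H) = \<theta>"

text \<open>Nodal values on the whole mesh belonging to a vector of unknowns, with the removed entries
  replaced as prescribed by the boundary and interface conditions.\<close>

definition nodal_value :: "multilayer \<Rightarrow> nat \<Rightarrow> real vec \<Rightarrow> nat \<Rightarrow> nat \<Rightarrow> real" where
  "nodal_value P n u i j =
     (if removed_left P (i, j) then cL P / aL P
      else if removed_right P n (i, j) then cR P / aR P
      else if removed_above P (i, j)
        then u $ node_index P n (i - 1, n) / interface_ratio (iface P (i - 1))
      else if removed_below P n (i, j)
        then interface_ratio (iface P i) * u $ node_index P n (i + 1, 0)
      else u $ node_index P n (i, j))"

text \<open>Right-hand sides of the finite volume equations at the first and the last node of the mesh, at
  the right end of layer \<open>i\<close> and at the left end of layer \<open>i + 1\<close> (the nodes at interface \<open>i\<close>), and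
  at the interior nodes. Here \<open>v i j\<close> is the nodal value at node \<open>(i, j)\<close>. At a \<open>GI\<close> interface only
  one of the two interface nodes carries an unknown, and only its equation is used: that of
  \<open>(i, n)\<close> if \<open>\<theta> \<ge> 1\<close> and that of \<open>(i + 1, 0)\<close> if \<open>\<theta> < 1\<close>.\<close>

definition left_rhs :: "multilayer \<Rightarrow> nat \<Rightarrow> (nat \<Rightarrow> nat \<Rightarrow> real) \<Rightarrow> real" where
  "left_rhs P n v =
     (let h = mesh_width P n; D = diffusivity P in
      - (2 * D 1 / h 1) * (1 / h 1 + aL P / bL P) * v 1 0
      + 2 * D 1 / (h 1)\<^sup>2 * v 1 1
      + 2 * D 1 * cL P / (h 1 * bL P))"

definition right_rhs :: "multilayer \<Rightarrow> nat \<Rightarrow> (nat \<Rightarrow> nat \<Rightarrow> real) \<Rightarrow> real" where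
  "right_rhs P n v =
     (let h = mesh_width P n; D = diffusivity P; m = layers P in
      2 * D m / (h m)\<^sup>2 * v m (n - 1)
      - 2 * D m / h m * (1 / h m + aR P / bR P) * v m n
      + 2 * D m * cR P / (h m * bR P))"

definition interface_below_rhs :: "multilayer \<Rightarrow> nat \<Rightarrow> (nat \<Rightarrow> nat \<Rightarrow> real) \<Rightarrow> nat \<Rightarrow> real" where
  "interface_below_rhs P n v i =
     (let h = mesh_width P n; D = diffusivity P; \<gamma> = conductivity P in
      case iface P i of
        GI \<theta> \<Rightarrow>
          2 * D i * D (i + 1) * \<theta> / (\<gamma> i * h i * \<theta> * D (i + 1) + \<gamma> (i + 1) * h (i + 1) * D i) *
          (\<gamma> i / h i * v i (n - 1)
           - (\<gamma> i / h i + \<gamma> (i + 1) / (\<theta> * h (i + 1))) * v i n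
           + \<gamma> (i + 1) / h (i + 1) * v (i + 1) 1)
      | GII \<theta> H \<Rightarrow>
          2 * D i / (\<gamma> i * h i) *
          (\<gamma> i / h i * v i (n - 1)
           - (H + \<gamma> i / h i) * v i n
           + \<theta> * H * v (i + 1) 0))"

definition interface_above_rhs :: "multilayer \<Rightarrow> nat \<Rightarrow> (nat \<Rightarrow> nat \<Rightarrow> real) \<Rightarrow> nat \<Rightarrow> real" where
  "interface_above_rhs P n v i =
     (let h = mesh_width P n; D = diffusivity P; \<gamma> = conductivity P in
      case iface P i of
        GI \<theta> \<Rightarrow>
          2 * D i * D (i + 1) / (\<gamma> i * h i * \<theta> * D (i + 1) + \<gamma> (i + 1) * h (i + 1) * D i) *
          (\<gamma> i / h i * v i (n - 1)
           - (\<theta> * \<gamma> i / h i + \<gamma> (i + 1) / h (i + 1)) * v (i + 1) 0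
           + \<gamma> (i + 1) / h (i + 1) * v (i + 1) 1)
      | GII \<theta> H \<Rightarrow>
          2 * D (i + 1) / (\<gamma> (i + 1) * h (i + 1)) *
          (H * v i n
           - (\<theta> * H + \<gamma> (i + 1) / h (i + 1)) * v (i + 1) 0
           + \<gamma> (i + 1) / h (i + 1) * v (i + 1) 1))"

definition interior_rhs :: "multilayer \<Rightarrow> nat \<Rightarrow> (nat \<Rightarrow> nat \<Rightarrow> real) \<Rightarrow> nat \<Rightarrow> nat \<Rightarrow> real" where
  "interior_rhs P n v i j =
     diffusivity P i / (mesh_width P n i)\<^sup>2 * (v i (j + 1) - 2 * v i j + v i (j - 1))"

definition node_rhs :: "multilayer \<Rightarrow> nat \<Rightarrow> (nat \<Rightarrow> nat \<Rightarrow> real) \<Rightarrow> nat \<Rightarrow> nat \<Rightarrow> real" where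
  "node_rhs P n v i j =
     (if j = 0 then (if i = 1 then left_rhs P n v else interface_above_rhs P n v (i - 1))
      else if j = n then (if i = layers P then right_rhs P n v else interface_below_rhs P n v i)
      else interior_rhs P n v i j)"

definition fv_rhs :: "multilayer \<Rightarrow> nat \<Rightarrow> real vec \<Rightarrow> real vec" where
  "fv_rhs P n u =
     vec (num_unknowns P n) (\<lambda>k. case unknowns P n ! k of (i, j) \<Rightarrow> node_rhs P n (nodal_value P n u) i j)"

text \<open>The right-hand side is affine in the vector of unknowns, so that its constant term is its value
  at \<open>0\<close> and the coefficient of the unknown number \<open>q\<close> is the increment of the right-hand side
  from \<open>0\<close> to the unit vector number \<open>q\<close>; see \<open>fv_rhs_eq\<close> and \<open>fv_matrix_unique\<close> below.\<close>

definition fv_vector :: "multilayer \<Rightarrow> nat \<Rightarrow> real vec" where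
  "fv_vector P n = fv_rhs P n (0\<^sub>v (num_unknowns P n))"

definition fv_matrix :: "multilayer \<Rightarrow> nat \<Rightarrow> real mat" where
  "fv_matrix P n =
     mat (num_unknowns P n) (num_unknowns P n)
       (\<lambda>(p, q). fv_rhs P n (unit_vec (num_unknowns P n) q) $ p - fv_rhs P n (0\<^sub>v (num_unknowns P n)) $ p)"

definition forward_euler_matrix :: "multilayer \<Rightarrow> nat \<Rightarrow> real \<Rightarrow> real mat" where
  "forward_euler_matrix P n \<tau> = 1\<^sub>m (num_unknowns P n) + \<tau> \<cdot>\<^sub>m fv_matrix P n"

definition stable_iteration_matrix :: "real mat \<Rightarrow> bool" where
  "stable_iteration_matrix M \<longleftrightarrow> spectral_radius (map_mat complex_of_real M) \<le> 1"


lemma set_unknowns: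
  "set (unknowns P n) = {(i, j). 1 \<le> i \<and> i \<le> layers P \<and> j \<le> n \<and> \<not> removed P n (i, j)}"
  by (auto simp: unknowns_def)

lemma distinct_unknowns: "distinct (unknowns P n)"
  unfolding unknowns_def by (intro distinct_filter distinct_product) auto

lemma node_index_nth:
  assumes "k < num_unknowns P n"
  shows "node_index P n (unknowns P n ! k) = k"
proof -
  let ?xs = "unknowns P n"
  have k: "k < length ?xs" using assms by (simp add: num_unknowns_def)
  have "takeWhile (\<lambda>q. q \<noteq> ?xs ! k) ?xs = take k ?xs"
    using distinct_unknowns[of P n] k
    by (intro takeWhile_eq_take_P_nth) (auto simp: nth_eq_iff_index_eq)
  with k show ?thesis by (simp add: node_index_def)
qed

lemma node_index_less:
  assumes "p \<in> set (unknowns P n)"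
  shows "node_index P n p < num_unknowns P n"
proof -
  obtain k where "k < num_unknowns P n" "unknowns P n ! k = p"
    using assms by (auto simp: in_set_conv_nth num_unknowns_def)
  then show ?thesis using node_index_nth[of k P n] by simp
qed

lemma nodal_value_unknown:
  assumes "k < num_unknowns P n" "unknowns P n ! k = (i, j)"
  shows "nodal_value P n u i j = u $ k"
proof -
  have "(i, j) \<in> set (unknowns P n)"
    using assms by (metis nth_mem num_unknowns_def)
  then have "\<not> removed P n (i, j)" by (simp add: set_unknowns)
  then show ?thesis
    using node_index_nth[OF assms(1)] assms(2) by (simp add: removed_def nodal_value_def)
qed

definition affine_on :: "nat \<Rightarrow> (real vec \<Rightarrow> real) \<Rightarrow> bool" where
  "affine_on N f \<longleftrightarrow> (\<exists>c w. \<forall>u\<in>carrier_vec N. f u = c + (\<Sum>q<N. w q * u $ q))"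

lemma affine_on_const: "affine_on N (\<lambda>u. c)"
  unfolding affine_on_def by (intro exI[of _ c] exI[of _ "\<lambda>q. 0"]) simp

lemma affine_on_proj:
  assumes "k < N" shows "affine_on N (\<lambda>u. u $ k)"
  unfolding affine_on_def
proof (intro exI ballI)
  fix u :: "real vec"
  show "u $ k = 0 + (\<Sum>q<N. (if q = k then 1 else 0) * u $ q)"
    using assms by (simp add: if_distrib[of "\<lambda>x. x * _"] cong: if_cong)
qed

lemma affine_on_add:
  assumes "affine_on N f" "affine_on N g" shows "affine_on N (\<lambda>u. f u + g u)"
proof -
  obtain c w where f: "\<forall>u\<in>carrier_vec N. f u = c + (\<Sum>q<N. w q * u $ q)"
    using assms(1) unfolding affine_on_def by blast
  obtain d z where g: "\<forall>u\<in>carrier_vec N. g u = d + (\<Sum>q<N. z q * u $ q)"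
    using assms(2) unfolding affine_on_def by blast
  have "\<forall>u\<in>carrier_vec N. f u + g u = (c + d) + (\<Sum>q<N. (w q + z q) * u $ q)"
    using f g by (simp add: sum.distrib ring_distribs)
  then show ?thesis
    unfolding affine_on_def by (intro exI[of _ "c + d"] exI[of _ "\<lambda>q. w q + z q"])
qed

lemma affine_on_cmult:
  assumes "affine_on N f" shows "affine_on N (\<lambda>u. a * f u)"
proof -
  obtain c w where f: "\<forall>u\<in>carrier_vec N. f u = c + (\<Sum>q<N. w q * u $ q)"
    using assms unfolding affine_on_def by blast
  have "\<forall>u\<in>carrier_vec N. a * f u = a * c + (\<Sum>q<N. (a * w q) * u $ q)"
    using f by (simp add: sum_distrib_left ring_distribs mult.assoc)
  then show ?thesis
    unfolding affine_on_def by (intro exI[of _ "a * c"] exI[of _ "\<lambda>q. a * w q"])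
qed

lemma affine_on_diff:
  assumes "affine_on N f" "affine_on N g" shows "affine_on N (\<lambda>u. f u - g u)"
  using affine_on_add[OF assms(1) affine_on_cmult[OF assms(2), of "-1"]] by simp

lemma affine_on_divide:
  assumes "affine_on N f" shows "affine_on N (\<lambda>u. f u / a)"
  using affine_on_cmult[OF assms, of "1 / a"] by simp

lemma affine_on_if:
  assumes "c \<Longrightarrow> affine_on N f" "\<not> c \<Longrightarrow> affine_on N g"
  shows "affine_on N (\<lambda>u. if c then f u else g u)"
  using assms by (cases c) auto

lemmas affine_on_intros =
  affine_on_if affine_on_const affine_on_proj affine_on_add affine_on_diff affine_on_cmult affine_on_divide

lemma affine_on_expand:
  assumes "affine_on N f" "u \<in> carrier_vec N"
  shows "f u = f (0\<^sub>v N) + (\<Sum>q<N. (f (unit_vec N q) - f (0\<^sub>v N)) * u $ q)"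
proof -
  obtain c w where f: "\<And>u. u \<in> carrier_vec N \<Longrightarrow> f u = c + (\<Sum>q<N. w q * u $ q)"
    using assms(1) unfolding affine_on_def by blast
  have z: "f (0\<^sub>v N) = c" by (subst f) auto
  have "f (unit_vec N q) = c + w q" if "q < N" for q
  proof -
    have "(\<Sum>r<N. w r * unit_vec N q $ r) = (\<Sum>r<N. if r = q then w q else 0)"
      using that by (intro sum.cong) auto
    then show ?thesis using that by (subst f) auto
  qed
  then have "(\<Sum>q<N. (f (unit_vec N q) - f (0\<^sub>v N)) * u $ q) = (\<Sum>q<N. w q * u $ q)"
    by (intro sum.cong) (auto simp: z)
  then show ?thesis using f[OF assms(2)] z by simp
qed

lemma affine_on_nodal_value:
  assumes n: "n \<ge> 2" and ij: "1 \<le> i" "i \<le> layers P" "j \<le> n"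
  shows "affine_on (num_unknowns P n) (\<lambda>u. nodal_value P n u i j)"
proof -
  have above: "node_index P n (i - 1, n) < num_unknowns P n" if "removed_above P (i, j)"
    using that n ij
    by (intro node_index_less)
      (auto simp: set_unknowns removed_def removed_left_def removed_right_def removed_above_def
        removed_below_def)
  have below: "node_index P n (i + 1, 0) < num_unknowns P n" if "removed_below P n (i, j)"
    using that n ij
    by (intro node_index_less)
      (auto simp: set_unknowns removed_def removed_left_def removed_right_def removed_above_def
        removed_below_def)
  have other: "node_index P n (i, j) < num_unknowns P n" if "\<not> removed P n (i, j)"
    using that ij by (intro node_index_less) (auto simp: set_unknowns)
  show ?thesis
    using above below other unfolding nodal_value_def removed_def
    by (intro affine_on_intros) auto
qed

lemma affine_on_node_rhs:
  assumes n: "n \<ge> 2" and ij: "1 \<le> i" "i \<le> layers P" "j \<le> n"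
  shows "affine_on (num_unknowns P n) (\<lambda>u. node_rhs P n (nodal_value P n u) i j)"
proof -
  have v: "affine_on (num_unknowns P n) (\<lambda>u. nodal_value P n u k l)"
    if "1 \<le> k" "k \<le> layers P" "l \<le> n" for k l
    using affine_on_nodal_value[OF n that] .
  have above: "affine_on (num_unknowns P n) (\<lambda>u. interface_above_rhs P n (nodal_value P n u) k)"
    if "1 \<le> k" "k + 1 \<le> layers P" for k
    using n that
    by (cases "iface P k")
      (auto simp: interface_above_rhs_def Let_def simp del: One_nat_def intro!: affine_on_intros v)
  have below: "affine_on (num_unknowns P n) (\<lambda>u. interface_below_rhs P n (nodal_value P n u) k)"
    if "1 \<le> k" "k + 1 \<le> layers P" for k
    using n that
    by (cases "iface P k")
      (auto simp: interface_below_rhs_def Let_def simp del: One_nat_def intro!: affine_on_intros v)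
  show ?thesis
    unfolding node_rhs_def left_rhs_def right_rhs_def interior_rhs_def Let_def
    by (intro affine_on_intros above below v; use n ij in linarith)
qed

lemma fv_matrix_carrier: "fv_matrix P n \<in> carrier_mat (num_unknowns P n) (num_unknowns P n)"
  by (simp add: fv_matrix_def)

lemma fv_vector_carrier: "fv_vector P n \<in> carrier_vec (num_unknowns P n)"
  by (simp add: fv_vector_def fv_rhs_def)

theorem fv_rhs_eq:
  assumes n: "n \<ge> 2" and u: "u \<in> carrier_vec (num_unknowns P n)"
  shows "fv_rhs P n u = fv_matrix P n *\<^sub>v u + fv_vector P n"
proof (rule eq_vecI)
  let ?N = "num_unknowns P n"
  show "dim_vec (fv_rhs P n u) = dim_vec (fv_matrix P n *\<^sub>v u + fv_vector P n)"
    by (simp add: fv_rhs_def fv_vector_def)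
  fix p assume "p < dim_vec (fv_matrix P n *\<^sub>v u + fv_vector P n)"
  then have p: "p < ?N" by (simp add: fv_rhs_def fv_vector_def)
  obtain i j where ij: "unknowns P n ! p = (i, j)" by fastforce
  have "(i, j) \<in> set (unknowns P n)"
    using p ij by (metis nth_mem num_unknowns_def)
  then have b: "1 \<le> i" "i \<le> layers P" "j \<le> n" by (auto simp: set_unknowns)
  have f: "fv_rhs P n v $ p = node_rhs P n (nodal_value P n v) i j" for v
    using p ij by (simp add: fv_rhs_def)
  have "(fv_matrix P n *\<^sub>v u) $ p = (\<Sum>q<?N. fv_matrix P n $$ (p, q) * u $ q)"
    using p u fv_matrix_carrier[of P n]
    by (auto simp: scalar_prod_def atLeast0LessThan intro!: sum.cong)
  also have "\<dots> = (\<Sum>q<?N. (fv_rhs P n (unit_vec ?N q) $ p - fv_rhs P n (0\<^sub>v ?N) $ p) * u $ q)"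
    using p by (intro sum.cong) (auto simp: fv_matrix_def)
  finally show "fv_rhs P n u $ p = (fv_matrix P n *\<^sub>v u + fv_vector P n) $ p"
    using affine_on_expand[OF affine_on_node_rhs[OF n b] u] p fv_vector_carrier[of P n]
    by (simp add: f fv_vector_def)
qed

theorem fv_matrix_unique:
  assumes A: "A \<in> carrier_mat (num_unknowns P n) (num_unknowns P n)"
    and b: "b \<in> carrier_vec (num_unknowns P n)"
    and eq: "\<And>u. u \<in> carrier_vec (num_unknowns P n) \<Longrightarrow> fv_rhs P n u = A *\<^sub>v u + b"
  shows "A = fv_matrix P n" "b = fv_vector P n"
proof -
  let ?N = "num_unknowns P n"
  have "A *\<^sub>v 0\<^sub>v ?N = 0\<^sub>v ?N" using A by auto
  then show b': "b = fv_vector P n"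
    using eq[of "0\<^sub>v ?N"] b by (simp add: fv_vector_def)
  show "A = fv_matrix P n"
  proof (rule eq_matI)
    fix p q assume "p < dim_row (fv_matrix P n)" "q < dim_col (fv_matrix P n)"
    then have pq: "p < ?N" "q < ?N" by (auto simp: fv_matrix_def)
    have "fv_rhs P n (unit_vec ?N q) $ p = A $$ (p, q) + b $ p"
      using eq[of "unit_vec ?N q"] A b pq by simp
    then show "A $$ (p, q) = fv_matrix P n $$ (p, q)"
      using pq b' by (simp add: fv_matrix_def fv_vector_def)
  qed (use A in \<open>auto simp: fv_matrix_def\<close>)
qed

end

theory Submission
  imports Defs
begin

text \<open>The proof is an energy estimate. After the constant terms are dropped, the finite volume
  equations say that the flux \<open>\<gamma>\<^sub>i (u\<^sub>i\<^sub>,\<^sub>j\<^sub>+\<^sub>1 - u\<^sub>i\<^sub>,\<^sub>j) / h\<^sub>i\<close> is balanced over every control volume. The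
  condition \<open>u\<^sub>i = \<theta>\<^sub>i u\<^sub>i\<^sub>+\<^sub>1\<close> makes the unknowns jump while the flux is continuous, so that flux times
  value telescopes across the interfaces only if layer \<open>i\<close> carries the weight
  \<open>c\<^sub>i = \<theta>\<^sub>1 \<cdots> \<theta>\<^sub>i\<^sub>-\<^sub>1\<close>. With the inner product \<open>G\<close> that gives the node \<open>(i, j)\<close> the weight
  \<open>c\<^sub>i \<gamma>\<^sub>i h\<^sub>i / D\<^sub>i\<close>, halved at both ends of the layer, summation by parts in all layers yields
  \<open>G (A u) w = - E u w\<close> (\<open>green_identity\<close>), where \<open>E\<close> is a symmetric, positive semidefinite form: a sum
  of products of differences over the mesh cells and the type GII interfaces and of products of the
  values at the Robin boundaries.

  Hence \<open>I + \<tau> A\<close> is self-adjoint for \<open>G\<close>, its eigenvalues are real, and they lie in \<open>[-1, 1]\<close> as soon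
  as \<open>E u u \<le> (2 / \<tau>) G u u\<close> (\<open>spectral_radius_le_1_of_selfadjoint\<close>, \<open>stable_if_energy_le\<close>). That
  inequality follows term by term from \<open>(x - y)\<^sup>2 \<le> 2 x\<^sup>2 + 2 y\<^sup>2\<close> and, at a type GII interface, from
  \<open>(\<theta> y - x)\<^sup>2 \<le> (1 + \<theta>) x\<^sup>2 + \<theta> (1 + \<theta>) y\<^sup>2\<close> (\<open>energy_bound\<close>). The interior condition on \<open>\<tau>\<close>
  says that the difference quotients inside a layer do not use up the weight of its nodes; what is left
  at an end node, the \<open>slack\<close>, has to absorb the boundary or interface term there, and the Robin and
  type GII conditions on \<open>\<tau>\<close> say exactly that it does (\<open>slack_lower_bound\<close>).\<close>

section \<open>Self-adjoint contractions\<close>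

text \<open>For an eigenvector \<open>x + \<i> y\<close> with eigenvalue \<open>a + \<i> b\<close>, comparing \<open>G (B x) y\<close> with \<open>G (B y) x\<close> gives
  \<open>b (G x x + G y y) = 0\<close>, so \<open>b = 0\<close>; then \<open>a\<close> is the Rayleigh quotient of the pair \<open>x\<close>, \<open>y\<close>.
  Arguing with real and imaginary parts keeps the inner product real.\<close>

lemma spectral_radius_le_1_of_selfadjoint:
  fixes B :: "real mat" and G :: "real vec \<Rightarrow> real vec \<Rightarrow> real"
  assumes B: "B \<in> carrier_mat N N" and N: "N > 0"
    and lin: "\<And>a b u v w. u \<in> carrier_vec N \<Longrightarrow> v \<in> carrier_vec N \<Longrightarrow> w \<in> carrier_vec N \<Longrightarrow>
      G (a \<cdot>\<^sub>v u + b \<cdot>\<^sub>v v) w = a * G u w + b * G v w"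
    and sym: "\<And>u w. G u w = G w u"
    and pos: "\<And>u. u \<in> carrier_vec N \<Longrightarrow> u \<noteq> 0\<^sub>v N \<Longrightarrow> G u u > 0"
    and adj: "\<And>u w. u \<in> carrier_vec N \<Longrightarrow> w \<in> carrier_vec N \<Longrightarrow> G (B *\<^sub>v u) w = G u (B *\<^sub>v w)"
    and contr: "\<And>u. u \<in> carrier_vec N \<Longrightarrow> \<bar>G (B *\<^sub>v u) u\<bar> \<le> G u u"
  shows "spectral_radius (map_mat complex_of_real B) \<le> 1"
proof -
  let ?C = "map_mat complex_of_real B"
  have C: "?C \<in> carrier_mat N N" using B by simp
  obtain k where k: "eigenvalue ?C k" "spectral_radius ?C = norm k"
    using spectral_radius_mem_max(1)[OF C] N
    unfolding spectral_radius_def spectrum_def by auto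
  obtain z where z: "z \<in> carrier_vec N" "z \<noteq> 0\<^sub>v N" "?C *\<^sub>v z = k \<cdot>\<^sub>v z"
    using k(1) C unfolding eigenvalue_def eigenvector_def by auto
  define x where "x = map_vec Re z"
  define y where "y = map_vec Im z"
  have xy: "x \<in> carrier_vec N" "y \<in> carrier_vec N" using z(1) by (auto simp: x_def y_def)
  have row: "(\<Sum>q<N. complex_of_real (B $$ (p, q)) * z $ q) = k * z $ p" if "p < N" for p
  proof -
    have "(?C *\<^sub>v z) $ p = (\<Sum>q<N. complex_of_real (B $$ (p, q)) * z $ q)"
      using that B z(1) by (auto simp: scalar_prod_def atLeast0LessThan intro!: sum.cong)
    with z(1,3) that show ?thesis by simp
  qed
  have mv: "(B *\<^sub>v u) $ p = (\<Sum>q<N. B $$ (p, q) * u $ q)" if "p < N" "u \<in> carrier_vec N" for p u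
    using that B by (auto simp: scalar_prod_def atLeast0LessThan intro!: sum.cong)
  have Bx: "B *\<^sub>v x = Re k \<cdot>\<^sub>v x + (- Im k) \<cdot>\<^sub>v y"
  proof (rule eq_vecI)
    fix p assume "p < dim_vec (Re k \<cdot>\<^sub>v x + (- Im k) \<cdot>\<^sub>v y)"
    then have p: "p < N" using xy by simp
    have "(B *\<^sub>v x) $ p = Re (\<Sum>q<N. complex_of_real (B $$ (p, q)) * z $ q)"
      using z(1) unfolding mv[OF p xy(1)] by (simp add: x_def)
    then show "(B *\<^sub>v x) $ p = (Re k \<cdot>\<^sub>v x + (- Im k) \<cdot>\<^sub>v y) $ p"
      using p z(1) by (simp add: row x_def y_def)
  qed (use B xy in auto)
  have By: "B *\<^sub>v y = Im k \<cdot>\<^sub>v x + Re k \<cdot>\<^sub>v y"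
  proof (rule eq_vecI)
    fix p assume "p < dim_vec (Im k \<cdot>\<^sub>v x + Re k \<cdot>\<^sub>v y)"
    then have p: "p < N" using xy by simp
    have "(B *\<^sub>v y) $ p = Im (\<Sum>q<N. complex_of_real (B $$ (p, q)) * z $ q)"
      using z(1) unfolding mv[OF p xy(2)] by (simp add: y_def)
    then show "(B *\<^sub>v y) $ p = (Im k \<cdot>\<^sub>v x + Re k \<cdot>\<^sub>v y) $ p"
      using p z(1) by (simp add: row x_def y_def)
  qed (use B xy in auto)
  have nz: "x \<noteq> 0\<^sub>v N \<or> y \<noteq> 0\<^sub>v N"
  proof (rule ccontr)
    assume "\<not> ?thesis"
    then have "x $ p = 0 \<and> y $ p = 0" if "p < N" for p using that by simp
    then have "z = 0\<^sub>v N"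
      using z(1) by (intro eq_vecI) (auto simp: x_def y_def complex_eq_iff)
    with z(2) show False ..
  qed
  have nn: "G u u \<ge> 0" if "u \<in> carrier_vec N" for u
    using contr[OF that] by linarith
  have S: "G x x + G y y > 0"
    using nz pos[OF xy(1)] pos[OF xy(2)] nn[OF xy(1)] nn[OF xy(2)] by linarith
  have "G (B *\<^sub>v x) y = G (B *\<^sub>v y) x" using adj[OF xy] sym by simp
  then have "Im k * (G x x + G y y) = 0"
    unfolding Bx By lin[OF xy xy(1)] lin[OF xy xy(2)] using sym[of y x]
    by (simp add: algebra_simps)
  with S have im: "Im k = 0" by simp
  have "G (B *\<^sub>v x) x + G (B *\<^sub>v y) y = Re k * (G x x + G y y)"
    unfolding Bx By lin[OF xy xy(1)] lin[OF xy xy(2)] using sym[of y x] im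
    by (simp add: algebra_simps)
  moreover have "\<bar>G (B *\<^sub>v x) x + G (B *\<^sub>v y) y\<bar> \<le> G x x + G y y"
    using contr[OF xy(1)] contr[OF xy(2)] by linarith
  ultimately have "\<bar>Re k * (G x x + G y y)\<bar> \<le> 1 * (G x x + G y y)" by simp
  then have "\<bar>Re k\<bar> * (G x x + G y y) \<le> 1 * (G x x + G y y)"
    using S by (simp add: abs_mult)
  then have "\<bar>Re k\<bar> \<le> 1" using S mult_le_cancel_right_pos by blast
  then show ?thesis using k(2) im by (simp add: cmod_def)
qed

section \<open>Summation by parts in one layer\<close>

definition trapezoid :: "nat \<Rightarrow> nat \<Rightarrow> real" where
  "trapezoid n j = (if j = 0 \<or> j = n then 1 / 2 else 1)"

lemma sum_trapezoid_ends:
  assumes "n \<ge> 1"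
  shows "(\<Sum>j\<le>n. trapezoid n j * g j) = (g 0 + g n) / 2 + (\<Sum>j=1..<n. g j)"
proof -
  have "{..n} = insert 0 (insert n {1..<n})" using assms by auto
  moreover have "(\<Sum>j=1..<n. trapezoid n j * g j) = (\<Sum>j=1..<n. g j)"
    by (intro sum.cong) (auto simp: trapezoid_def)
  ultimately show ?thesis using assms by (simp add: trapezoid_def field_simps)
qed

lemma sum_cells_eq_trapezoid:
  assumes "n \<ge> 1"
  shows "(\<Sum>j<n. g j + g (j + 1)) = 2 * (\<Sum>j\<le>n. trapezoid n j * g j)"
  unfolding sum_trapezoid_ends[OF assms] using assms
proof (induction n rule: nat_induct_at_least)
  case (Suc n)
  then show ?case by (simp add: sum.atLeastLessThan_Suc field_simps)
qed simp

lemma second_difference_by_parts: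
  fixes v w :: "nat \<Rightarrow> real"
  assumes "n \<ge> 1"
  shows "(\<Sum>j=1..<n. (v (j + 1) - 2 * v j + v (j - 1)) * w j) =
    (v n - v (n - 1)) * w n - (v 1 - v 0) * w 0 - (\<Sum>j<n. (v (j + 1) - v j) * (w (j + 1) - w j))"
  using assms
proof (induction n rule: nat_induct_at_least)
  case base then show ?case by (simp add: algebra_simps)
next
  case (Suc n)
  then show ?case by (simp add: sum.atLeastLessThan_Suc algebra_simps)
qed

text \<open>The terms in parentheses on the right-hand side are the fluxes through the two ends of the layer: the
  balance over the half control volume at an end node yields them from the difference quotient next to
  that node.\<close>

lemma layer_by_parts:
  fixes f v w :: "nat \<Rightarrow> real"
  assumes n: "n \<ge> 1"
    and int: "\<And>j. 1 \<le> j \<Longrightarrow> j < n \<Longrightarrow> K * f j = \<kappa> * (v (j + 1) - 2 * v j + v (j - 1))"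
  shows "K * (\<Sum>j\<le>n. trapezoid n j * (f j * w j)) =
    (K * f n / 2 + \<kappa> * (v n - v (n - 1))) * w n - (\<kappa> * (v 1 - v 0) - K * f 0 / 2) * w 0
    - \<kappa> * (\<Sum>j<n. (v (j + 1) - v j) * (w (j + 1) - w j))"
proof -
  have "K * (\<Sum>j=1..<n. f j * w j) = \<kappa> * (\<Sum>j=1..<n. (v (j + 1) - 2 * v j + v (j - 1)) * w j)"
    unfolding sum_distrib_left using int
    by (intro sum.cong) (auto simp: mult.assoc[symmetric])
  then show ?thesis
    unfolding sum_trapezoid_ends[OF n] distrib_left second_difference_by_parts[OF n]
    by (simp add: algebra_simps add_divide_distrib diff_divide_distrib)
qed

text \<open>Every interior node belongs to two mesh cells and every end node to one, so that
  \<open>(x - y)\<^sup>2 \<le> 2 x\<^sup>2 + 2 y\<^sup>2\<close> reproduces the trapezoidal weights with \<open>2 \<kappa>\<close> in place of \<open>K\<close>. The remaining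
  \<open>K - 2 \<kappa>\<close> is kept only at the end nodes, where it is needed for the boundary and interface terms.\<close>

lemma layer_energy_bound:
  fixes v :: "nat \<Rightarrow> real"
  assumes n: "n \<ge> 1" and \<kappa>: "0 \<le> \<kappa>" "2 * \<kappa> \<le> K"
  shows "\<kappa> * (\<Sum>j<n. (v (j + 1) - v j)\<^sup>2) + (K - 2 * \<kappa>) * ((v 0)\<^sup>2 + (v n)\<^sup>2)
    \<le> 2 * K * (\<Sum>j\<le>n. trapezoid n j * (v j)\<^sup>2)"
proof -
  let ?T = "\<Sum>j\<le>n. trapezoid n j * (v j)\<^sup>2"
  have "(v (j + 1) - v j)\<^sup>2 \<le> 2 * ((v j)\<^sup>2 + (v (j + 1))\<^sup>2)" for j
    using zero_le_power2[of "v (j + 1) + v j"] by (simp add: power2_eq_square algebra_simps)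
  then have "(\<Sum>j<n. (v (j + 1) - v j)\<^sup>2) \<le> 2 * (\<Sum>j<n. (v j)\<^sup>2 + (v (j + 1))\<^sup>2)"
    unfolding sum_distrib_left by (intro sum_mono)
  also have "\<dots> = 4 * ?T" using sum_cells_eq_trapezoid[OF n, of "\<lambda>j. (v j)\<^sup>2"] by simp
  finally have 1: "\<kappa> * (\<Sum>j<n. (v (j + 1) - v j)\<^sup>2) \<le> \<kappa> * (4 * ?T)"
    using \<kappa>(1) by (rule mult_left_mono)
  have "(v 0)\<^sup>2 + (v n)\<^sup>2 \<le> 2 * ?T"
    unfolding sum_trapezoid_ends[OF n] by (simp add: sum_nonneg add_divide_distrib)
  then have 2: "(K - 2 * \<kappa>) * ((v 0)\<^sup>2 + (v n)\<^sup>2) \<le> (K - 2 * \<kappa>) * (2 * ?T)"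
    using \<kappa>(2) by (intro mult_left_mono) auto
  show ?thesis using add_mono[OF 1 2] by (simp add: algebra_simps)
qed

text \<open>Regroups the contributions of the right (\<open>f\<close>) and left (\<open>g\<close>) ends of the layers by interface.\<close>

lemma sum_ends_by_interface:
  fixes f g :: "nat \<Rightarrow> real"
  assumes "m \<ge> 1"
  shows "(\<Sum>i=1..m. f i + g i) = g 1 + f m + (\<Sum>i=1..<m. f i + g (i + 1))"
  using assms
proof (induction m rule: nat_induct_at_least)
  case (Suc m)
  then show ?case by (simp add: sum.atLeastLessThan_Suc)
qed simp

section \<open>Weighted inner product and energy on the mesh\<close>

locale fv_mesh =
  fixes P :: multilayer and n :: nat
  assumes problem: "multilayer_problem P"
    and n: "n \<ge> 2"
begin

abbreviation "m \<equiv> layers P"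
abbreviation "N \<equiv> num_unknowns P n"
abbreviation "h \<equiv> mesh_width P n"
abbreviation "D \<equiv> diffusivity P"
abbreviation "\<gamma> \<equiv> conductivity P"

definition conductance :: "nat \<Rightarrow> real" where
  "conductance i = \<gamma> i / h i"

definition capacity :: "nat \<Rightarrow> real" where
  "capacity i = \<gamma> i * h i / D i"

text \<open>With these weights \<open>c\<^sub>i \<phi> u\<^sub>i - c\<^sub>i\<^sub>+\<^sub>1 \<phi> u\<^sub>i\<^sub>+\<^sub>1 = 0\<close> for a flux \<open>\<phi>\<close> that is continuous at an interface
  with \<open>u\<^sub>i = \<theta>\<^sub>i u\<^sub>i\<^sub>+\<^sub>1\<close>.\<close>

definition layer_weight :: "nat \<Rightarrow> real" where
  "layer_weight i = (\<Prod>k=1..<i. interface_ratio (iface P k))"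

definition interface_energy :: "(nat \<Rightarrow> nat \<Rightarrow> real) \<Rightarrow> (nat \<Rightarrow> nat \<Rightarrow> real) \<Rightarrow> nat \<Rightarrow> real" where
  "interface_energy v w i =
     (case iface P i of
        GI \<theta> \<Rightarrow> 0
      | GII \<theta> H \<Rightarrow>
          layer_weight i * H * ((\<theta> * v (i + 1) 0 - v i n) * (\<theta> * w (i + 1) 0 - w i n)))"

text \<open>In the Dirichlet case \<open>bL P = 0\<close> (or \<open>bR P = 0\<close>) division by zero makes the boundary term vanish,
  as it should.\<close>

definition energy :: "(nat \<Rightarrow> nat \<Rightarrow> real) \<Rightarrow> (nat \<Rightarrow> nat \<Rightarrow> real) \<Rightarrow> real" where
  "energy v w =
     (\<Sum>i=1..m. layer_weight i * conductance i *
        (\<Sum>j<n. (v i (j + 1) - v i j) * (w i (j + 1) - w i j)))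
     + (\<Sum>i=1..<m. interface_energy v w i)
     + \<gamma> 1 * aL P / bL P * (v 1 0 * w 1 0)
     + layer_weight m * \<gamma> m * aR P / bR P * (v m n * w m n)"

definition grid_inner :: "(nat \<Rightarrow> nat \<Rightarrow> real) \<Rightarrow> (nat \<Rightarrow> nat \<Rightarrow> real) \<Rightarrow> real" where
  "grid_inner v w =
     (\<Sum>i=1..m. layer_weight i * capacity i * (\<Sum>j\<le>n. trapezoid n j * (v i j * w i j)))"

text \<open>The relations by which the removed nodal values are replaced, without their constant terms.\<close>

definition homogeneous_grid :: "(nat \<Rightarrow> nat \<Rightarrow> real) \<Rightarrow> bool" where
  "homogeneous_grid v \<longleftrightarrow>
     (bL P = 0 \<longrightarrow> v 1 0 = 0) \<and> (bR P = 0 \<longrightarrow> v m n = 0) \<and>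
     (\<forall>i\<in>{1..<m}. \<forall>\<theta>. iface P i = GI \<theta> \<longrightarrow> v i n = \<theta> * v (i + 1) 0)"

text \<open>Subtracting the nodal values of the zero vector removes the Dirichlet data and leaves the part that is
  linear in \<open>u\<close>.\<close>

definition grid :: "real vec \<Rightarrow> nat \<Rightarrow> nat \<Rightarrow> real" where
  "grid u i j = nodal_value P n u i j - nodal_value P n (0\<^sub>v N) i j"

lemma m_pos: "m \<ge> 1"
  using problem by (simp add: multilayer_problem_def)

lemma
  assumes "1 \<le> i" "i \<le> m"
  shows h_pos: "h i > 0" and D_pos: "D i > 0" and \<gamma>_pos: "\<gamma> i > 0"
proof -
  have "endpoint P (i - 1) < endpoint P (i - 1 + 1)"
    using problem assms unfolding multilayer_problem_def
    by (metis One_nat_def Suc_pred less_eq_Suc_le)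
  then show "h i > 0" using assms n by (simp add: mesh_width_def)
  show "D i > 0" "\<gamma> i > 0" using problem assms by (auto simp: multilayer_problem_def)
qed

lemma boundary_coeffs_nonneg: "aL P \<ge> 0" "bL P \<ge> 0" "aR P \<ge> 0" "bR P \<ge> 0"
  using problem by (auto simp: multilayer_problem_def)

lemma iface_ok: "1 \<le> i \<Longrightarrow> i < m \<Longrightarrow> interface_ok (iface P i)"
  using problem by (simp add: multilayer_problem_def)

lemma interface_ratio_pos:
  assumes "1 \<le> i" "i < m" shows "interface_ratio (iface P i) > 0"
  using iface_ok[OF assms] by (cases "iface P i") auto

lemma layer_weight_1 [simp]: "layer_weight 1 = 1"
  by (simp add: layer_weight_def)

lemma layer_weight_step:
  "1 \<le> i \<Longrightarrow> layer_weight (i + 1) = layer_weight i * interface_ratio (iface P i)"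
  by (simp add: layer_weight_def)

lemma layer_weight_pos: "i \<le> m \<Longrightarrow> layer_weight i > 0"
  unfolding layer_weight_def by (intro prod_pos interface_ratio_pos) auto

lemma capacity_pos: "1 \<le> i \<Longrightarrow> i \<le> m \<Longrightarrow> capacity i > 0"
  using h_pos D_pos \<gamma>_pos by (simp add: capacity_def)

lemma conductance_pos: "1 \<le> i \<Longrightarrow> i \<le> m \<Longrightarrow> conductance i > 0"
  using h_pos \<gamma>_pos by (simp add: conductance_def)

lemmas removed_defs = removed_def removed_left_def removed_right_def removed_above_def removed_below_def

lemma energy_commute: "energy v w = energy w v"
proof -
  have "interface_energy v w i = interface_energy w v i" for i
    by (simp add: interface_energy_def mult.commute split: interface.split)
  then show ?thesis unfolding energy_def by (simp add: mult.commute)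
qed

lemma energy_nonneg: "energy v v \<ge> 0"
proof -
  have "layer_weight i * conductance i * (\<Sum>j<n. (v i (j + 1) - v i j) * (v i (j + 1) - v i j)) \<ge> 0"
    if "i \<in> {1..m}" for i
    using that less_imp_le[OF conductance_pos[of i]] less_imp_le[OF layer_weight_pos[of i]]
    by (intro mult_nonneg_nonneg sum_nonneg zero_le_square) auto
  moreover have "interface_energy v v i \<ge> 0" if "i \<in> {1..<m}" for i
    using that iface_ok[of i] layer_weight_pos[of i]
    by (auto simp: interface_energy_def split: interface.split)
  moreover have "\<gamma> 1 * aL P / bL P * (v 1 0 * v 1 0) \<ge> 0"
    using less_imp_le[OF \<gamma>_pos[of 1]] m_pos boundary_coeffs_nonneg
    by (intro mult_nonneg_nonneg divide_nonneg_nonneg zero_le_square) auto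
  moreover have "layer_weight m * \<gamma> m * aR P / bR P * (v m n * v m n) \<ge> 0"
    using less_imp_le[OF \<gamma>_pos[of m]] less_imp_le[OF layer_weight_pos[of m]] m_pos boundary_coeffs_nonneg
    by (intro mult_nonneg_nonneg divide_nonneg_nonneg zero_le_square) auto
  ultimately show ?thesis unfolding energy_def
    by (intro add_nonneg_nonneg sum_nonneg) auto
qed

section \<open>Green's identity\<close>

text \<open>The constant terms of the affine right-hand sides are removed by taking differences:
  \<open>v\<close> is a difference of two grid functions \<open>a\<close> and \<open>b\<close>, and \<open>f\<close> stands for the linear part of the
  finite volume operator applied to \<open>v\<close>. At removed nodes, \<open>f\<close> is extended by the same relations as
  \<open>v\<close>; this makes the interface equations of both cases of type GI the same.\<close>

context
  fixes v f a b :: "nat \<Rightarrow> nat \<Rightarrow> real"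
  assumes v: "\<And>i j. v i j = a i j - b i j"
    and f: "\<And>i j. 1 \<le> i \<Longrightarrow> i \<le> m \<Longrightarrow> j \<le> n \<Longrightarrow> \<not> removed P n (i, j) \<Longrightarrow>
      f i j = node_rhs P n a i j - node_rhs P n b i j"
    and hv: "homogeneous_grid v"
    and hf: "homogeneous_grid f"
begin

lemma interior_equation:
  assumes i: "1 \<le> i" "i \<le> m" and j: "1 \<le> j" "j < n"
  shows "capacity i * f i j = conductance i * (v i (j + 1) - 2 * v i j + v i (j - 1))"
proof -
  have "\<not> removed P n (i, j)" using j by (auto simp: removed_defs)
  then have "f i j = D i / (h i)\<^sup>2 * (v i (j + 1) - 2 * v i j + v i (j - 1))"
    using f[of i j] i j by (simp add: node_rhs_def interior_rhs_def v diff_divide_distrib add_divide_distrib algebra_simps)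
  then show ?thesis
    using h_pos[OF i] D_pos[OF i]
    by (simp add: capacity_def conductance_def power2_eq_square)
qed

text \<open>Fluxes \<open>\<gamma>\<^sub>i u\<^sub>i'\<close> through the left and right end of layer \<open>i\<close>, computed from the balance over the half
  control volume in that layer.\<close>

definition flux_left :: "nat \<Rightarrow> real" where
  "flux_left i = conductance i * (v i 1 - v i 0) - capacity i * f i 0 / 2"

definition flux_right :: "nat \<Rightarrow> real" where
  "flux_right i = capacity i * f i n / 2 + conductance i * (v i n - v i (n - 1))"

lemma left_flux:
  assumes "homogeneous_grid w"
  shows "flux_left 1 * w 1 0 = \<gamma> 1 * aL P / bL P * (v 1 0 * w 1 0)"
proof (cases "bL P = 0")
  case True
  then show ?thesis using assms by (simp add: homogeneous_grid_def)
next
  case False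
  then have "\<not> removed P n (1, 0)" using n by (auto simp: removed_defs)
  then have eq: "f 1 0 = - (2 * D 1 / h 1) * (1 / h 1 + aL P / bL P) * v 1 0 + 2 * D 1 / (h 1)\<^sup>2 * v 1 1"
    using f[of 1 0] m_pos by (simp add: node_rhs_def left_rhs_def Let_def v diff_divide_distrib add_divide_distrib algebra_simps)
  have "flux_left 1 = \<gamma> 1 * aL P / bL P * v 1 0"
    using h_pos[of 1] D_pos[of 1] m_pos False
    unfolding flux_left_def capacity_def conductance_def eq by (simp add: field_simps power2_eq_square)
  then show ?thesis by simp
qed

lemma right_flux:
  assumes "homogeneous_grid w"
  shows "flux_right m * w m n = - (\<gamma> m * aR P / bR P * (v m n * w m n))"
proof (cases "bR P = 0")
  case True
  then show ?thesis using assms by (simp add: homogeneous_grid_def)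
next
  case False
  then have "\<not> removed P n (m, n)" using n by (auto simp: removed_defs)
  then have eq: "f m n = 2 * D m / (h m)\<^sup>2 * v m (n - 1) - 2 * D m / h m * (1 / h m + aR P / bR P) * v m n"
    using f[of m n] m_pos n by (simp add: node_rhs_def right_rhs_def Let_def v diff_divide_distrib add_divide_distrib algebra_simps)
  have "flux_right m = - (\<gamma> m * aR P / bR P * v m n)"
    using h_pos[of m] D_pos[of m] m_pos False
    unfolding flux_right_def capacity_def conductance_def eq by (simp add: field_simps power2_eq_square)
  then show ?thesis by simp
qed

text \<open>The equation at a type GI interface is the balance over the control volume that consists of both
  half volumes at the interface; split by layers, it says that the two fluxes agree.\<close>

lemma flux_continuous_GI:
  assumes i: "1 \<le> i" "i < m" and GI: "iface P i = GI \<theta>"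
  shows "flux_right i = flux_left (i + 1)"
proof -
  have \<theta>: "\<theta> > 0" using iface_ok[OF i] GI by simp
  have pos: "h i > 0" "D i > 0" "\<gamma> i > 0" "h (i + 1) > 0" "D (i + 1) > 0" "\<gamma> (i + 1) > 0"
    using i by (auto intro!: h_pos D_pos \<gamma>_pos)
  let ?R = "\<gamma> i * h i * \<theta> * D (i + 1) + \<gamma> (i + 1) * h (i + 1) * D i"
  have R: "?R > 0" using pos \<theta> by (simp add: add_pos_pos)
  have v0: "v i n = \<theta> * v (i + 1) 0" and f0: "f i n = \<theta> * f (i + 1) 0"
    using hv hf i GI by (auto simp: homogeneous_grid_def)
  \<comment> \<open>Written in terms of the left end of layer \<open>i + 1\<close>, the equations for \<open>\<theta> \<ge> 1\<close> and \<open>\<theta> < 1\<close> coincide.\<close>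
  have f': "f (i + 1) 0 = 2 * D i * D (i + 1) / ?R *
    (\<gamma> i / h i * v i (n - 1) - (\<theta> * \<gamma> i / h i + \<gamma> (i + 1) / h (i + 1)) * v (i + 1) 0
      + \<gamma> (i + 1) / h (i + 1) * v (i + 1) 1)"
  proof (cases "\<theta> \<ge> 1")
    case True
    have "\<not> removed P n (i, n)" using n i GI True by (auto simp: removed_defs)
    then have "f i n = 2 * D i * D (i + 1) * \<theta> / ?R *
      (\<gamma> i / h i * v i (n - 1) - (\<gamma> i / h i + \<gamma> (i + 1) / (\<theta> * h (i + 1))) * v i n
        + \<gamma> (i + 1) / h (i + 1) * v (i + 1) 1)"
      using f[of i n] i n GI
      by (simp add: node_rhs_def interface_below_rhs_def Let_def v right_diff_distrib distrib_left)
    also have "\<dots> = \<theta> * (2 * D i * D (i + 1) / ?R *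
      (\<gamma> i / h i * v i (n - 1) - (\<theta> * \<gamma> i / h i + \<gamma> (i + 1) / h (i + 1)) * v (i + 1) 0
        + \<gamma> (i + 1) / h (i + 1) * v (i + 1) 1))"
    proof -
      have "(\<gamma> i / h i + \<gamma> (i + 1) / (\<theta> * h (i + 1))) * v i n
        = (\<theta> * \<gamma> i / h i + \<gamma> (i + 1) / h (i + 1)) * v (i + 1) 0"
        unfolding v0 using \<theta> by (simp add: distrib_left distrib_right)
      then show ?thesis by simp
    qed
    finally show ?thesis unfolding f0 using \<theta> mult_left_cancel[of \<theta>] by (metis less_irrefl)
  next
    case False
    have "\<not> removed P n (i + 1, 0)" using n i GI False by (auto simp: removed_defs)
    then show ?thesis
      using f[of "i + 1" 0] i n GI
      by (simp add: node_rhs_def interface_above_rhs_def Let_def v right_diff_distrib distrib_left)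
  qed
  let ?B = "\<gamma> i / h i * v i (n - 1) - (\<theta> * \<gamma> i / h i + \<gamma> (i + 1) / h (i + 1)) * v (i + 1) 0
      + \<gamma> (i + 1) / h (i + 1) * v (i + 1) 1"
  have "(capacity i * \<theta> + capacity (i + 1)) / 2 * f (i + 1) 0 = ?B"
  proof -
    have "(capacity i * \<theta> + capacity (i + 1)) / 2 = ?R / (2 * D i * D (i + 1))"
      using pos by (simp add: capacity_def add_divide_distrib)
    moreover have "x / y * (y / x * z) = z" if "x > 0" "y > 0" for x y z :: real
      using that by simp
    ultimately show ?thesis unfolding f' using pos R by (simp only: mult_pos_pos zero_less_numeral)
  qed
  then show ?thesis
    unfolding flux_right_def flux_left_def f0 v0 conductance_def
    by (simp add: algebra_simps add_divide_distrib diff_divide_distrib)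
qed

lemma flux_GII:
  assumes i: "1 \<le> i" "i < m" and GII: "iface P i = GII \<theta> H"
  shows "flux_right i = H * (\<theta> * v (i + 1) 0 - v i n)"
    and "flux_left (i + 1) = H * (\<theta> * v (i + 1) 0 - v i n)"
proof -
  have pos: "h i > 0" "D i > 0" "\<gamma> i > 0" "h (i + 1) > 0" "D (i + 1) > 0" "\<gamma> (i + 1) > 0"
    using i by (auto intro!: h_pos D_pos \<gamma>_pos)
  have "\<not> removed P n (i, n)" using n i GII by (auto simp: removed_defs)
  then have eqr: "f i n = 2 * D i / (\<gamma> i * h i) *
    (\<gamma> i / h i * v i (n - 1) - (H + \<gamma> i / h i) * v i n + \<theta> * H * v (i + 1) 0)"
    using f[of i n] i n GII
    by (simp add: node_rhs_def interface_below_rhs_def Let_def v right_diff_distrib distrib_left)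
  show "flux_right i = H * (\<theta> * v (i + 1) 0 - v i n)"
    using pos unfolding flux_right_def capacity_def conductance_def eqr by (simp add: field_simps)
  have "\<not> removed P n (i + 1, 0)" using n i GII by (auto simp: removed_defs)
  then have eql: "f (i + 1) 0 = 2 * D (i + 1) / (\<gamma> (i + 1) * h (i + 1)) *
    (H * v i n - (\<theta> * H + \<gamma> (i + 1) / h (i + 1)) * v (i + 1) 0
      + \<gamma> (i + 1) / h (i + 1) * v (i + 1) 1)"
    using f[of "i + 1" 0] i n GII
    by (simp add: node_rhs_def interface_above_rhs_def Let_def v right_diff_distrib distrib_left)
  show "flux_left (i + 1) = H * (\<theta> * v (i + 1) 0 - v i n)"
    using pos unfolding flux_left_def capacity_def conductance_def eql by (simp add: field_simps)
qed

lemma interface_flux: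
  assumes w: "homogeneous_grid w" and i: "1 \<le> i" "i < m"
  shows "layer_weight i * (flux_right i * w i n) - layer_weight (i + 1) * (flux_left (i + 1) * w (i + 1) 0)
    = - interface_energy v w i"
proof (cases "iface P i")
  case (GI \<theta>)
  then have "w i n = \<theta> * w (i + 1) 0" using w i by (simp add: homogeneous_grid_def)
  then show ?thesis
    unfolding layer_weight_step[OF i(1)] flux_continuous_GI[OF i GI] interface_energy_def
    by (simp add: GI)
next
  case (GII \<theta> H)
  show ?thesis
    unfolding layer_weight_step[OF i(1)] flux_GII[OF i GII] interface_energy_def
    by (simp add: GII algebra_simps)
qed

text \<open>Summation by parts in each layer leaves the end fluxes, which are then collected interface by
  interface.\<close>

lemma green_identity:
  assumes w: "homogeneous_grid w"
  shows "grid_inner f w = - energy v w"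
proof -
  let ?c = layer_weight
  let ?S = "\<lambda>i. ?c i * conductance i * (\<Sum>j<n. (v i (j + 1) - v i j) * (w i (j + 1) - w i j))"
  let ?r = "\<lambda>i. ?c i * (flux_right i * w i n)" and ?l = "\<lambda>i. - (?c i * (flux_left i * w i 0))"
  have "grid_inner f w = (\<Sum>i=1..m. (?r i + ?l i) - ?S i)"
    unfolding grid_inner_def
  proof (intro sum.cong refl)
    fix i assume "i \<in> {1..m}"
    then have i: "1 \<le> i" "i \<le> m" by auto
    have "capacity i * (\<Sum>j\<le>n. trapezoid n j * (f i j * w i j)) =
      flux_right i * w i n - flux_left i * w i 0
      - conductance i * (\<Sum>j<n. (v i (j + 1) - v i j) * (w i (j + 1) - w i j))"
      unfolding flux_right_def flux_left_def using n
      by (intro layer_by_parts interior_equation[OF i]) auto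
    then show "?c i * capacity i * (\<Sum>j\<le>n. trapezoid n j * (f i j * w i j)) = (?r i + ?l i) - ?S i"
      by (simp only: mult.assoc) (simp add: right_diff_distrib)
  qed
  also have "\<dots> = (\<Sum>i=1..m. ?r i + ?l i) - (\<Sum>i=1..m. ?S i)"
    by (rule sum_subtractf)
  also have "(\<Sum>i=1..m. ?r i + ?l i) = ?l 1 + ?r m + (\<Sum>i=1..<m. ?r i + ?l (i + 1))"
    using sum_ends_by_interface[OF m_pos] .
  also have "(\<Sum>i=1..<m. ?r i + ?l (i + 1)) = (\<Sum>i=1..<m. - interface_energy v w i)"
    using interface_flux[OF w] by (intro sum.cong) auto
  finally show ?thesis
    unfolding left_flux[OF w] right_flux[OF w] energy_def layer_weight_1
    by (simp add: sum_negf)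
qed

end

section \<open>Upper bound for the energy\<close>

text \<open>Half of the difference between the two sides of \<open>E u u \<le> (2 / \<tau>) G u u\<close> at a node inside layer \<open>i\<close>
  (up to the weight of the layer), and the whole of it at an end node before the boundary and
  interface terms are counted.\<close>


definition slack :: "real \<Rightarrow> nat \<Rightarrow> real" where
  "slack \<tau> i = capacity i / \<tau> - 2 * conductance i"

text \<open>At a type GII interface the energy splits as
  \<open>H (\<theta> y - x)\<^sup>2 \<le> (1 + \<theta>) H x\<^sup>2 + \<theta> (1 + \<theta>) H y\<^sup>2\<close>, and the extra factor \<open>\<theta>\<close> of \<open>y\<^sup>2\<close> is the ratio of the
  two layer weights. So both layers have to provide the same amount \<open>(1 + \<theta>) H\<close> of slack.\<close>

lemma energy_bound:
  assumes tau: "\<tau> > 0" and hv: "homogeneous_grid v"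
    and interior: "\<And>i. i \<in> {1..m} \<Longrightarrow> slack \<tau> i \<ge> 0"
    and left: "bL P \<noteq> 0 \<Longrightarrow> \<gamma> 1 * aL P / bL P \<le> slack \<tau> 1"
    and right: "bR P \<noteq> 0 \<Longrightarrow> \<gamma> m * aR P / bR P \<le> slack \<tau> m"
    and GII: "\<And>i \<theta> H. i \<in> {1..<m} \<Longrightarrow> iface P i = GII \<theta> H \<Longrightarrow>
      (1 + \<theta>) * H \<le> slack \<tau> i \<and> (1 + \<theta>) * H \<le> slack \<tau> (i + 1)"
  shows "energy v v \<le> 2 / \<tau> * grid_inner v v"
proof -
  let ?c = layer_weight
  let ?S = "\<lambda>i. ?c i * conductance i * (\<Sum>j<n. (v i (j + 1) - v i j) * (v i (j + 1) - v i j))"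
  let ?r = "\<lambda>i. ?c i * (slack \<tau> i * (v i n)\<^sup>2)" and ?l = "\<lambda>i. ?c i * (slack \<tau> i * (v i 0)\<^sup>2)"
  have iface: "interface_energy v v i \<le> ?r i + ?l (i + 1)" if "i \<in> {1..<m}" for i
  proof (cases "iface P i")
    case (GI \<theta>)
    have "?r i \<ge> 0" "?l (i + 1) \<ge> 0"
      using interior[of i] interior[of "i + 1"] that
        less_imp_le[OF layer_weight_pos[of i]] less_imp_le[OF layer_weight_pos[of "i + 1"]]
      by (auto intro!: mult_nonneg_nonneg)
    then show ?thesis by (simp add: interface_energy_def GI)
  next
    case (GII \<theta> H)
    have pos: "\<theta> > 0" "H > 0" "?c i > 0" "?c (i + 1) > 0"
      using that iface_ok[of i] GII layer_weight_pos[of i] layer_weight_pos[of "i + 1"] by auto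
    let ?a = "v i n" and ?b = "v (i + 1) 0"
    have "0 \<le> \<theta> * (?a + ?b)\<^sup>2" using pos by simp
    then have "(\<theta> * ?b - ?a)\<^sup>2 \<le> (1 + \<theta>) * ?a\<^sup>2 + \<theta> * ((1 + \<theta>) * ?b\<^sup>2)"
      by (simp add: power2_eq_square algebra_simps)
    then have "?c i * H * (\<theta> * ?b - ?a)\<^sup>2 \<le> ?c i * H * ((1 + \<theta>) * ?a\<^sup>2 + \<theta> * ((1 + \<theta>) * ?b\<^sup>2))"
      using pos by (intro mult_left_mono) auto
    also have "\<dots> = ?c i * ((1 + \<theta>) * H * ?a\<^sup>2) + ?c (i + 1) * ((1 + \<theta>) * H * ?b\<^sup>2)"
      using that layer_weight_step[of i] by (simp add: GII algebra_simps)
    also have "\<dots> \<le> ?r i + ?l (i + 1)"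
      using assms(6)[OF that GII] pos
      by (intro add_mono mult_left_mono mult_right_mono) auto
    finally show ?thesis by (simp add: interface_energy_def GII power2_eq_square)
  qed
  have l: "\<gamma> 1 * aL P / bL P * (v 1 0 * v 1 0) \<le> ?l 1"
  proof (cases "bL P = 0")
    case True then show ?thesis using hv by (simp add: homogeneous_grid_def)
  next
    case False
    show ?thesis
      unfolding layer_weight_1 mult_1 power2_eq_square
      by (intro mult_right_mono left False zero_le_square)
  qed
  have r: "?c m * \<gamma> m * aR P / bR P * (v m n * v m n) \<le> ?r m"
  proof (cases "bR P = 0")
    case True then show ?thesis using hv by (simp add: homogeneous_grid_def)
  next
    case False
    have "?c m * (\<gamma> m * aR P / bR P * (v m n * v m n)) \<le> ?r m"
      unfolding power2_eq_square
      using layer_weight_pos[of m] by (intro mult_left_mono mult_right_mono right False zero_le_square) auto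
    then show ?thesis by (simp add: mult.assoc)
  qed
  have S: "?S i + (?r i + ?l i) \<le> 2 / \<tau> * (?c i * capacity i * (\<Sum>j\<le>n. trapezoid n j * (v i j * v i j)))"
    if "i \<in> {1..m}" for i
  proof -
    have "conductance i * (\<Sum>j<n. (v i (j + 1) - v i j)\<^sup>2) + slack \<tau> i * ((v i 0)\<^sup>2 + (v i n)\<^sup>2)
      \<le> 2 * (capacity i / \<tau>) * (\<Sum>j\<le>n. trapezoid n j * (v i j)\<^sup>2)"
      unfolding slack_def using n that conductance_pos[of i] interior[OF that]
      by (intro layer_energy_bound) (auto simp: slack_def)
    then have "?c i * (conductance i * (\<Sum>j<n. (v i (j + 1) - v i j)\<^sup>2) + slack \<tau> i * ((v i 0)\<^sup>2 + (v i n)\<^sup>2))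
      \<le> ?c i * (2 * (capacity i / \<tau>) * (\<Sum>j\<le>n. trapezoid n j * (v i j)\<^sup>2))"
      using layer_weight_pos[of i] that by (intro mult_left_mono) auto
    then show ?thesis by (simp add: power2_eq_square algebra_simps)
  qed
  have "energy v v \<le> (\<Sum>i=1..m. ?S i) + (\<Sum>i=1..<m. ?r i + ?l (i + 1)) + ?l 1 + ?r m"
    unfolding energy_def by (intro add_mono order_refl sum_mono iface l r)
  also have "\<dots> = (\<Sum>i=1..m. ?S i) + (\<Sum>i=1..m. ?r i + ?l i)"
    unfolding sum_ends_by_interface[OF m_pos] by simp
  also have "\<dots> = (\<Sum>i=1..m. ?S i + (?r i + ?l i))"
    by (simp only: sum.distrib)
  also have "\<dots> \<le> 2 / \<tau> * grid_inner v v"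
    unfolding grid_inner_def sum_distrib_left[of "2 / \<tau>"] by (intro sum_mono S)
  finally show ?thesis .
qed

text \<open>The common form of the interior, Robin and type GII conditions: \<open>a = 0\<close> inside the layer,
  \<open>a / b\<close> the ratio of the boundary coefficients at a Robin boundary, and \<open>a = (1 + \<theta>) H\<close>, \<open>b = \<gamma>\<^sub>i\<close> at a
  type GII interface.\<close>

lemma slack_lower_bound:
  assumes i: "1 \<le> i" "i \<le> m" and tau: "\<tau> > 0" and b: "b > 0" and a: "a \<ge> 0"
    and le: "\<tau> \<le> 2 * b / (2 * b + a * h i) * ((h i)\<^sup>2 / (2 * D i))"
  shows "\<gamma> i * a / b \<le> slack \<tau> i"
proof -
  have pos: "h i > 0" "D i > 0" "\<gamma> i > 0" using i by (auto intro: h_pos D_pos \<gamma>_pos)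
  have s: "2 * b + a * h i > 0" using a b pos by (simp add: add_pos_nonneg)
  have "(2 * b + a * h i) * D i * \<tau> \<le> b * (h i)\<^sup>2"
  proof -
    have "2 * b / (2 * b + a * h i) * ((h i)\<^sup>2 / (2 * D i)) = b * (h i)\<^sup>2 / ((2 * b + a * h i) * D i)"
      by simp
    then show ?thesis using le s pos by (simp add: pos_le_divide_eq mult.commute)
  qed
  then have "(a + 2 * b / h i) / b \<le> h i / (D i * \<tau>)"
    using b pos tau by (simp add: field_simps power2_eq_square)
  then have "\<gamma> i * ((a + 2 * b / h i) / b) \<le> \<gamma> i * (h i / (D i * \<tau>))"
    using pos by (intro mult_left_mono) auto
  then show ?thesis
    using b unfolding slack_def capacity_def conductance_def
    by (simp add: add_divide_distrib distrib_left)
qed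

section \<open>Grid functions of vectors of unknowns\<close>

lemma grid_linear:
  assumes "1 \<le> i" "i \<le> m" "j \<le> n" and "u \<in> carrier_vec N" "w \<in> carrier_vec N"
  shows "grid (a \<cdot>\<^sub>v u + b \<cdot>\<^sub>v w) i j = a * grid u i j + b * grid w i j"
proof -
  define e where "e q = nodal_value P n (unit_vec N q) i j - nodal_value P n (0\<^sub>v N) i j" for q
  have g: "grid x i j = (\<Sum>q<N. e q * x $ q)" if "x \<in> carrier_vec N" for x
    using affine_on_expand[OF affine_on_nodal_value[OF n assms(1-3)] that] by (simp add: grid_def e_def)
  have "grid (a \<cdot>\<^sub>v u + b \<cdot>\<^sub>v w) i j = (\<Sum>q<N. a * (e q * u $ q) + b * (e q * w $ q))"
    using assms(4,5) by (subst g) (auto intro!: sum.cong simp: algebra_simps)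
  also have "\<dots> = a * grid u i j + b * grid w i j"
    using assms(4,5) by (simp add: g sum.distrib sum_distrib_left)
  finally show ?thesis .
qed

lemma homogeneous_grid_grid: "homogeneous_grid (grid u)"
proof -
  have "nodal_value P n x i n = \<theta> * nodal_value P n x (i + 1) 0"
    if "i \<in> {1..<m}" "iface P i = GI \<theta>" for x i \<theta>
    using that n iface_ok[of i] by (auto simp: nodal_value_def removed_defs)
  then show ?thesis
    unfolding homogeneous_grid_def grid_def
    by (auto simp: nodal_value_def removed_defs right_diff_distrib simp del: One_nat_def)
qed

lemma grid_unknown:
  assumes "k < N" "unknowns P n ! k = (i, j)"
  shows "grid u i j = u $ k"
  using assms by (simp add: grid_def nodal_value_unknown)

lemma grid_fv_matrix:
  assumes u: "u \<in> carrier_vec N" and ij: "1 \<le> i" "i \<le> m" "j \<le> n" "\<not> removed P n (i, j)"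
  shows "grid (fv_matrix P n *\<^sub>v u) i j =
    node_rhs P n (nodal_value P n u) i j - node_rhs P n (nodal_value P n (0\<^sub>v N)) i j"
proof -
  have "(i, j) \<in> set (unknowns P n)" using ij by (simp add: set_unknowns)
  then obtain k where k: "k < N" "unknowns P n ! k = (i, j)"
    by (auto simp: in_set_conv_nth num_unknowns_def)
  have "fv_rhs P n u $ k = (fv_matrix P n *\<^sub>v u) $ k + fv_rhs P n (0\<^sub>v N) $ k"
    unfolding fv_rhs_eq[OF n u] using k fv_vector_carrier[of P n] fv_matrix_carrier[of P n]
    by (simp add: fv_vector_def)
  then show ?thesis using k by (simp add: grid_unknown fv_rhs_def)
qed

lemma fv_green_identity:
  assumes "u \<in> carrier_vec N"
  shows "grid_inner (grid (fv_matrix P n *\<^sub>v u)) (grid w) = - energy (grid u) (grid w)"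
  by (rule green_identity[OF grid_def grid_fv_matrix[OF assms]])
    (auto intro: homogeneous_grid_grid)

lemma grid_inner_commute: "grid_inner v w = grid_inner w v"
  unfolding grid_inner_def by (simp add: mult.commute)

lemma grid_inner_linear:
  assumes "u \<in> carrier_vec N" "v \<in> carrier_vec N"
  shows "grid_inner (grid (a \<cdot>\<^sub>v u + b \<cdot>\<^sub>v v)) w = a * grid_inner (grid u) w + b * grid_inner (grid v) w"
proof -
  have "(\<Sum>j\<le>n. trapezoid n j * (grid (a \<cdot>\<^sub>v u + b \<cdot>\<^sub>v v) i j * w i j)) =
    a * (\<Sum>j\<le>n. trapezoid n j * (grid u i j * w i j)) + b * (\<Sum>j\<le>n. trapezoid n j * (grid v i j * w i j))"
    if "i \<in> {1..m}" for i
    unfolding sum_distrib_left sum.distrib[symmetric]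
    using that assms by (intro sum.cong) (auto simp: grid_linear algebra_simps)
  then have "grid_inner (grid (a \<cdot>\<^sub>v u + b \<cdot>\<^sub>v v)) w =
    (\<Sum>i=1..m. a * (layer_weight i * capacity i * (\<Sum>j\<le>n. trapezoid n j * (grid u i j * w i j)))
      + b * (layer_weight i * capacity i * (\<Sum>j\<le>n. trapezoid n j * (grid v i j * w i j))))"
    unfolding grid_inner_def by (intro sum.cong refl) (simp only: distrib_left mult.left_commute)
  then show ?thesis
    unfolding grid_inner_def sum.distrib by (simp only: sum_distrib_left)
qed

lemma grid_inner_pos:
  assumes u: "u \<in> carrier_vec N" "u \<noteq> 0\<^sub>v N"
  shows "grid_inner (grid u) (grid u) > 0"
proof -
  obtain k where k: "k < N" "u $ k \<noteq> 0"
    using u by (metis carrier_vecD eq_vecI index_zero_vec)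
  obtain i j where ij: "unknowns P n ! k = (i, j)" by fastforce
  have "(i, j) \<in> set (unknowns P n)" using k ij by (metis nth_mem num_unknowns_def)
  then have b: "1 \<le> i" "i \<le> m" "j \<le> n" by (auto simp: set_unknowns)
  have t: "trapezoid n l > 0" for l by (simp add: trapezoid_def)
  let ?T = "\<lambda>i. \<Sum>l\<le>n. trapezoid n l * (grid u i l * grid u i l)"
  have T: "?T i \<ge> 0" for i
    using less_imp_le[OF t] by (intro sum_nonneg mult_nonneg_nonneg zero_le_square)
  have "?T i > 0"
  proof (rule sum_pos2[of _ j])
    show "0 < trapezoid n j * (grid u i j * grid u i j)"
      using t[of j] k(2) grid_unknown[OF k(1) ij]
      by (simp only: zero_less_mult_iff linorder_neq_iff) auto
    show "0 \<le> trapezoid n l * (grid u i l * grid u i l)" for l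
      using less_imp_le[OF t[of l]] by simp
  qed (use b in auto)
  have c: "layer_weight l * capacity l > 0" if "l \<in> {1..m}" for l
    using that layer_weight_pos[of l] capacity_pos[of l] by simp
  show ?thesis unfolding grid_inner_def
  proof (rule sum_pos2[of _ i])
    show "0 < layer_weight i * capacity i * ?T i" using c[of i] b \<open>?T i > 0\<close> by simp
    show "0 \<le> layer_weight l * capacity l * ?T l" if "l \<in> {1..m}" for l
      using less_imp_le[OF c[OF that]] T by (rule mult_nonneg_nonneg)
  qed (use b in auto)
qed

lemma num_unknowns_pos: "N > 0"
proof -
  have "(1, 1) \<in> set (unknowns P n)" using m_pos n by (auto simp: set_unknowns removed_defs)
  then show ?thesis by (auto simp: num_unknowns_def)
qed

section \<open>Stability of the forward Euler scheme\<close>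

lemma stable_if_energy_le:
  assumes tau: "\<tau> > 0"
    and le: "\<And>v. homogeneous_grid v \<Longrightarrow> energy v v \<le> 2 / \<tau> * grid_inner v v"
  shows "stable_iteration_matrix (forward_euler_matrix P n \<tau>)"
proof -
  let ?A = "fv_matrix P n" and ?B = "forward_euler_matrix P n \<tau>"
  have A: "?A \<in> carrier_mat N N" by (rule fv_matrix_carrier)
  have B: "?B \<in> carrier_mat N N" using A by (simp add: forward_euler_matrix_def)
  have Bu: "?B *\<^sub>v u = 1 \<cdot>\<^sub>v u + \<tau> \<cdot>\<^sub>v (?A *\<^sub>v u)" if "u \<in> carrier_vec N" for u
    using that A unfolding forward_euler_matrix_def
    by (intro eq_vecI) (auto simp: add_mult_distrib_mat_vec[of _ N N] scalar_prod_def sum_distrib_left mult.assoc intro!: sum.cong)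
  have G: "grid_inner (grid (?B *\<^sub>v u)) (grid w) = grid_inner (grid u) (grid w) - \<tau> * energy (grid u) (grid w)"
    if u: "u \<in> carrier_vec N" for u w
  proof -
    have "?A *\<^sub>v u \<in> carrier_vec N" using A u by simp
    then show ?thesis
      unfolding Bu[OF u] grid_inner_linear[OF u \<open>?A *\<^sub>v u \<in> carrier_vec N\<close>]
      by (simp add: fv_green_identity[OF u])
  qed
  have "spectral_radius (map_mat complex_of_real ?B) \<le> 1"
  proof (rule spectral_radius_le_1_of_selfadjoint[OF B num_unknowns_pos,
        where G = "\<lambda>u w. grid_inner (grid u) (grid w)"])
    fix u w :: "real vec" assume u: "u \<in> carrier_vec N" and w: "w \<in> carrier_vec N"
    show "grid_inner (grid (?B *\<^sub>v u)) (grid w) = grid_inner (grid u) (grid (?B *\<^sub>v w))"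
      unfolding grid_inner_commute[of "grid u" "grid (?B *\<^sub>v w)"] G[OF u] G[OF w]
      by (simp add: energy_commute grid_inner_commute)
  next
    fix u :: "real vec" assume u: "u \<in> carrier_vec N"
    have "\<tau> * energy (grid u) (grid u) \<le> 2 * grid_inner (grid u) (grid u)"
      using le[OF homogeneous_grid_grid, of u] tau by (simp add: field_simps)
    moreover have "\<tau> * energy (grid u) (grid u) \<ge> 0" using tau energy_nonneg by simp
    ultimately show "\<bar>grid_inner (grid (?B *\<^sub>v u)) (grid u)\<bar> \<le> grid_inner (grid u) (grid u)"
      unfolding G[OF u] by (simp add: abs_le_iff)
  qed (auto intro: grid_inner_linear grid_inner_pos grid_inner_commute)
  then show ?thesis by (simp add: stable_iteration_matrix_def)
qed


end

theorem mainTheorem3: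
  fixes P :: multilayer and m n :: nat and \<tau> :: real and h D \<gamma> :: "nat \<Rightarrow> real"
  assumes problem: "multilayer_problem P"
    and n: "n \<ge> 2"
    and conv: "m = layers P" "h = mesh_width P n" "D = diffusivity P" "\<gamma> = conductivity P"
    and tau: "\<tau> > 0"
    and interior: "\<And>i. i \<in> {1..m} \<Longrightarrow> \<tau> \<le> (h i)\<^sup>2 / (2 * D i)"
    and left_robin: "aL P \<noteq> 0 \<Longrightarrow> bL P \<noteq> 0 \<Longrightarrow>
      \<tau> \<le> (2 * bL P / (2 * bL P + aL P * h 1)) * ((h 1)\<^sup>2 / (2 * D 1))"
    and right_robin: "aR P \<noteq> 0 \<Longrightarrow> bR P \<noteq> 0 \<Longrightarrow>
      \<tau> \<le> (2 * bR P / (2 * bR P + aR P * h m)) * ((h m)\<^sup>2 / (2 * D m))"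
    and GI_gt_1: "\<And>i \<theta>. i \<in> {1..<m} \<Longrightarrow> iface P i = GI \<theta> \<Longrightarrow> \<theta> > 1 \<Longrightarrow>
      \<tau> \<le> (\<gamma> i * h i * \<theta> * D (i + 1) + \<gamma> (i + 1) * h (i + 1) * D i) * h i * h (i + 1) /
          ((2 * \<theta> * \<gamma> i * h (i + 1) + (1 + \<theta>) * \<gamma> (i + 1) * h i) * D i * D (i + 1))"
    and GI_less_1: "\<And>i \<theta>. i \<in> {1..<m} \<Longrightarrow> iface P i = GI \<theta> \<Longrightarrow> \<theta> < 1 \<Longrightarrow>
      \<tau> \<le> (\<gamma> i * h i * \<theta> * D (i + 1) + \<gamma> (i + 1) * h (i + 1) * D i) * h i * h (i + 1) /
          (((1 + \<theta>) * \<gamma> i * h (i + 1) + 2 * \<gamma> (i + 1) * h i) * D i * D (i + 1))"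
    and GII: "\<And>i \<theta> H. i \<in> {1..<m} \<Longrightarrow> iface P i = GII \<theta> H \<Longrightarrow>
      \<tau> \<le> min
        ((2 * \<gamma> i / ((1 + \<theta>) * H * h i + 2 * \<gamma> i)) * ((h i)\<^sup>2 / (2 * D i)))
        ((2 * \<gamma> (i + 1) / ((1 + \<theta>) * H * h (i + 1) + 2 * \<gamma> (i + 1))) *
           ((h (i + 1))\<^sup>2 / (2 * D (i + 1))))"
  shows "stable_iteration_matrix (forward_euler_matrix P n \<tau>)"
proof -
  interpret fv_mesh P n using problem n by unfold_locales
  note [simp] = conv
  have slack: "slack \<tau> i \<ge> 0" if "1 \<le> i" "i \<le> m" for i
    using slack_lower_bound[of i \<tau> 1 0] interior[of i] that tau by simp
  have m1: "1 \<le> m" using m_pos by simp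
  show ?thesis
  proof (rule stable_if_energy_le[OF tau], rule energy_bound[OF tau])
    assume "bL P \<noteq> 0"
    then show "conductivity P 1 * aL P / bL P \<le> slack \<tau> 1"
      using slack_lower_bound[of 1 \<tau> "bL P" "aL P"] left_robin slack[of 1] m1 tau boundary_coeffs_nonneg
      by (cases "aL P = 0") auto
  next
    assume "bR P \<noteq> 0"
    then show "conductivity P (layers P) * aR P / bR P \<le> slack \<tau> (layers P)"
      using slack_lower_bound[of m \<tau> "bR P" "aR P"] right_robin slack[of m] m1 tau boundary_coeffs_nonneg
      by (cases "aR P = 0") auto
  next
    fix i \<theta> H assume i: "i \<in> {1..<layers P}" and iface: "iface P i = GII \<theta> H"
    have pos: "\<theta> > 0" "H > 0" using iface_ok[of i] i iface by auto
    have "\<gamma> k * ((1 + \<theta>) * H) / \<gamma> k \<le> slack \<tau> k" if "k = i \<or> k = i + 1" for k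
      using slack_lower_bound[of k \<tau> "\<gamma> k" "(1 + \<theta>) * H"] GII[OF _ iface] i pos that tau \<gamma>_pos[of k]
      by (auto simp: add.commute)
    from this[of i] this[of "i + 1"]
    show "(1 + \<theta>) * H \<le> slack \<tau> i \<and> (1 + \<theta>) * H \<le> slack \<tau> (i + 1)"
      using \<gamma>_pos[of i] \<gamma>_pos[of "i + 1"] i by simp
  qed (use slack in auto)
qed

end
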